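(* Let $\mathcal R_{\mathrm{LU}}=\mathbb E\left[\mathbf 1_{\{\theta_{\mathrm{LU}}\le\theta_{\max}\}}\,B_{\mathrm{LU}}\log_2(1+\mathrm{SNR}_{\mathrm{LU}})\right]$ be the average data rate of the associated leader satellite. Then $$\mathcal R_{\mathrm{LU}}=\int_0^{\theta_{\max}}\int_0^\infty B_{\mathrm{LU}}\,f_{W_{\mathrm U}}(w)\,f_{\theta_{\mathrm{LU}}}(\theta)\,\log_2\left(1+\frac{\xi_{\mathrm{LU}}\,w}{r_{\mathrm{LU}}^2(\theta)}\right)\mathrm dw\,\mathrm d\theta,$$ where $r_{\mathrm{LU}}(\theta)=\sqrt{R_{\mathrm{sat}}^2+R_\oplus^2-2R_{\mathrm{sat}}R_\oplus\cos\theta}$ and $f_{\theta_{\mathrm{LU}}}(\theta)=\frac{N_{\mathrm L}\sin\theta}{2}\left(\frac{1+\cos\theta}{2}\right)^{N_{\mathrm L}-1}$.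
   Context: Geometry: $R_\oplus>0$ is the Earth radius, $h_{\mathrm{sat}}>0$, $R_{\mathrm{sat}}=R_\oplus+h_{\mathrm{sat}}$. The user is a fixed point on the sphere of radius $R_\oplus$ centred at the Earth's centre $O$. $N_{\mathrm L}\ge1$ leader satellites are i.i.d. uniformly distributed on the sphere of radius $R_{\mathrm{sat}}$ centred at $O$ (homogeneous binomial point process). The central angle between two devices is the angle at $O$ between the segments joining $O$ to them. The associated leader is the leader nearest to the user, and $\theta_{\mathrm{LU}}$ is the central angle between it and the user. $\theta_{\max}$ is the maximum central angle at which a leader can serve the user, $0<\theta_{\max}\le\arccos(R_\oplus/R_{\mathrm{sat}})-\theta_{\mathrm{cap}}$ with a constant $\theta_{\mathrm{cap}}>0$. Channel: $\mathrm{SNR}_{\mathrm{LU}}=\xi_{\mathrm{LU}}W_{\mathrm U}/r_{\mathrm{LU}}^2$, where $r_{\mathrm{LU}}$ is the Euclidean distance between the associated leader and the user, and $\xi_{\mathrm{LU}}=\rho_{\mathrm{LU}}G_{\mathrm{LU}}\zeta_{\mathrm U}\left(\frac{\nu_{\mathrm{LU}}}{4\pi\sigma_{\mathrm U}}\right)^2>0$ is a constant (transmit power, antenna gain, rain attenuation, wavelength, noise standard deviation, all positive). $B_{\mathrm{LU}}>0$ is the bandwidth. $W_{\mathrm U}\ge0$ is the shadowed-Rician fading power, independent of the satellite positions, with density $f_{W_{\mathrm U}}$ and CDF (parameters $\Omega,b_0,m>0$) $$F_{W_{\mathrm U}}(w)=\left(\frac{2b_0m}{2b_0m+\Omega}\right)^m\sum_{z=0}^\infty\frac{(m)_z}{z!\,\Gamma(z+1)}\left(\frac{\Omega}{2b_0m+\Omega}\right)^z\int_0^{w/(2b_0)}t^ze^{-t}\,\mathrm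 dt,\quad w\ge0,$$ with $(m)_z$ the Pochhammer symbol. *)

theory Defs
  imports "HOL-Probability.Probability"
begin

(* Normalised surface area on the sphere of radius R > 0 about c.  The surface area of a Borel
   subset A of the sphere is 3 / R times the volume of the solid cone over A with apex c, so the
   uniform distribution is the radial projection of the uniform distribution on the ball
   (the point 0, where the projection is undefined, is null). *)
definition uniform_sphere :: "real^3 \<Rightarrow> real \<Rightarrow> (real^3) measure" where
  "uniform_sphere c R =
     distr (uniform_measure lborel (cball 0 1)) borel (\<lambda>x. c + (R / norm x) *\<^sub>R x)"

definition central_angle :: "real^3 \<Rightarrow> real^3 \<Rightarrow> real^3 \<Rightarrow> real" where
  "central_angle c x y = arccos (((x - c) \<bullet> (y - c)) / (norm (x - c) * norm (y - c)))"

(* If several leaders are nearest, the index is an arbitrary one of them; for leaders on a common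
   sphere about c, neither r_LU nor theta_LU depends on this choice. *)
definition associated_leader :: "nat \<Rightarrow> real^3 \<Rightarrow> (nat \<Rightarrow> real^3) \<Rightarrow> nat" where
  "associated_leader N user x = arg_min_on (\<lambda>i. dist (x i) user) {..<N}"

definition r_LU :: "nat \<Rightarrow> real^3 \<Rightarrow> (nat \<Rightarrow> real^3) \<Rightarrow> real" where
  "r_LU N user x = dist (x (associated_leader N user x)) user"

definition theta_LU :: "real^3 \<Rightarrow> nat \<Rightarrow> real^3 \<Rightarrow> (nat \<Rightarrow> real^3) \<Rightarrow> real" where
  "theta_LU c N user x = central_angle c (x (associated_leader N user x)) user"

definition xi_LU :: "real \<Rightarrow> real \<Rightarrow> real \<Rightarrow> real \<Rightarrow> real \<Rightarrow> real" where
  "xi_LU \<rho> G \<zeta> \<nu> \<sigma> = \<rho> * G * \<zeta> * (\<nu> / (4 * pi * \<sigma>))\<^sup>2"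

definition SNR_LU :: "real \<Rightarrow> nat \<Rightarrow> real^3 \<Rightarrow> (nat \<Rightarrow> real^3) \<Rightarrow> real \<Rightarrow> real" where
  "SNR_LU \<xi> N user x w = \<xi> * w / (r_LU N user x)\<^sup>2"

definition shadowed_rician_cdf :: "real \<Rightarrow> real \<Rightarrow> real \<Rightarrow> real \<Rightarrow> real" where
  "shadowed_rician_cdf \<Omega> b0 m w =
     (2 * b0 * m / (2 * b0 * m + \<Omega>)) powr m *
     (\<Sum>z. pochhammer m z / (fact z * Gamma (real z + 1)) *
          (\<Omega> / (2 * b0 * m + \<Omega>)) ^ z *
          (LBINT t:{0..w / (2 * b0)}. t ^ z * exp (- t)))"

definition average_rate_LU ::
  "'w measure \<Rightarrow> real^3 \<Rightarrow> nat \<Rightarrow> real^3 \<Rightarrow> (nat \<Rightarrow> 'w \<Rightarrow> real^3) \<Rightarrow> ('w \<Rightarrow> real) \<Rightarrow>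
   real \<Rightarrow> real \<Rightarrow> real \<Rightarrow> real" where
  "average_rate_LU M c N user X W \<theta>max \<xi> B =
     (\<integral>\<omega>. indicator {..\<theta>max} (theta_LU c N user (\<lambda>i. X i \<omega>)) *
          (B * log 2 (1 + SNR_LU \<xi> N user (\<lambda>i. X i \<omega>) (W \<omega>))) \<partial>M)"

definition r_of_angle :: "real \<Rightarrow> real \<Rightarrow> real \<Rightarrow> real" where
  "r_of_angle Rsat R0 \<theta> = sqrt (Rsat\<^sup>2 + R0\<^sup>2 - 2 * Rsat * R0 * cos \<theta>)"

definition f_theta_LU :: "nat \<Rightarrow> real \<Rightarrow> real" where
  "f_theta_LU N \<theta> = real N * sin \<theta> / 2 * ((1 + cos \<theta>) / 2) ^ (N - 1)"

end

theory Submission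
  imports Defs
begin

text \<open>Up to null sets, the central angle of the nearest leader is the minimum of the leaders' angles, and
  the law of cosines expresses its distance to the user through this angle. By Archimedes' theorem a
  uniformly distributed leader is within angle \<open>a\<close> of the user with probability \<open>(1 - cos a) / 2\<close>,
  so by independence \<open>1 - ((1 + cos a) / 2) ^ N\<close> is the distribution function of the nearest angle, with
  derivative \<open>f_theta_LU N\<close>. Only \<open>a < pi / 2\<close> is needed because \<open>\<theta>max < arccos (R0 / Rsat)\<close>.
  Independence of the fading and Fubini's theorem then give the double integral.\<close>

section \<open>Volume of spherical sectors\<close>

text \<open>The set lies in discs of arbitrarily small area: the radius \<open>sqrt (e / pi)\<close>
  gives area \<open>e\<close>.\<close>

lemma emeasure_disc_zero:
  fixes A :: "'a set"
  assumes "card A = 2"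
  shows "emeasure (Pi\<^sub>M A (\<lambda>_. lborel))
    ({f. sqrt (\<Sum>i\<in>A. (f i)\<^sup>2) \<le> 0} \<inter> space (Pi\<^sub>M A (\<lambda>_. lborel))) = 0"
    (is "emeasure ?M (?S 0) = 0")
proof -
  have fin: "finite A" using assms by (metis card.infinite zero_neq_numeral)
  have "emeasure ?M (?S 0) \<le> 0 + ennreal e" if "0 < e" for e
  proof -
    have "emeasure ?M (?S 0) \<le> emeasure ?M (?S (sqrt (e / pi)))"
    proof (rule emeasure_mono)
      show "?S 0 \<subseteq> ?S (sqrt (e / pi))"
        using that by (auto intro: order_trans[of _ 0])
      show "?S (sqrt (e / pi)) \<in> sets ?M" using fin by measurable
    qed
    also have "\<dots> = ennreal (unit_ball_vol (real (card A)) * sqrt (e / pi) ^ card A)"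
      using that fin by (intro emeasure_cball_aux) auto
    also have "\<dots> = ennreal e"
      using assms that by (simp add: unit_ball_vol_2)
    finally show ?thesis by simp
  qed
  then have "emeasure ?M (?S 0) \<le> 0"
    by (rule ennreal_le_epsilon)
  then show ?thesis by simp
qed

text \<open>Meant for the slices of a spherical sector orthogonal to its axis \<open>e\<close>:
  \<open>A\<close> will be \<open>Basis - {e}\<close>, hence the abstract index set. Radius 0 is
  included because slices degenerate to points, for example at height 0.\<close>

lemma emeasure_disc:
  fixes A :: "'a set"
  assumes "card A = 2" "0 \<le> r"
  shows "emeasure (Pi\<^sub>M A (\<lambda>_. lborel))
    ({f. sqrt (\<Sum>i\<in>A. (f i)\<^sup>2) \<le> r} \<inter> space (Pi\<^sub>M A (\<lambda>_. lborel))) = ennreal (pi * r\<^sup>2)"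
proof (cases "r = 0")
  case True
  then show ?thesis using emeasure_disc_zero[OF assms(1)] by simp
next
  case False
  have "finite A" using assms by (metis card.infinite zero_neq_numeral)
  with False assms emeasure_cball_aux[of A r] show ?thesis
    by (simp add: unit_ball_vol_2)
qed

text \<open>Cavalieri's principle: the areas of the slices orthogonal to \<open>e\<close> are
  integrated over the height. With a basis vector as axis, the height is one of the coordinates of
  the product measure.\<close>

lemma emeasure_spherical_sector_Basis:
  fixes e :: "'a::euclidean_space"
  assumes "DIM('a) = 3" "e \<in> Basis" "0 < t" "t \<le> 1"
  shows "emeasure lborel {x \<in> cball 0 1. t * norm x \<le> x \<bullet> e} = ennreal (2 / 3 * pi * (1 - t))"
    (is "emeasure lborel ?S = _")
proof -
  interpret product_sigma_finite "\<lambda>_::'a. lborel :: real measure" by standard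
  define A where "A = Basis - {e}"
  have A: "finite A" "e \<notin> A" "Basis = insert e A" "card A = 2"
    using assms by (auto simp: A_def)
  \<comment> \<open>\<open>g\<close> assembles a vector from its coordinates; \<open>lborel\<close>
    is the image of the product measure under it.\<close>
  define g where "g = (\<lambda>f. \<Sum>b\<in>Basis. f b *\<^sub>R b :: 'a)"
  have g_meas[measurable]: "g \<in> measurable (Pi\<^sub>M Basis (\<lambda>_. lborel)) borel"
    unfolding g_def by simp
  have g_inner: "g f \<bullet> b = f b" if "b \<in> Basis" for f b
    using that by (simp add: g_def)
  have g_norm: "norm (g f) = sqrt (\<Sum>b\<in>Basis. (f b)\<^sup>2)" for f
    by (simp add: norm_eq_sqrt_inner euclidean_inner[of "g f" "g f"] g_inner power2_eq_square)
  \<comment> \<open>The slice at height \<open>z\<close> is a disc, bounded by the cone for \<open>z \<le> t\<close> and by the sphere for \<open>z \<ge> t\<close>.\<close>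
  define \<rho> where "\<rho> = (\<lambda>z. if z \<le> t then sqrt (1 - t\<^sup>2) / t * z else sqrt (1 - z\<^sup>2))"
  have t2: "t\<^sup>2 \<le> 1" using assms by (simp add: power_le_one)
  have \<rho>_nonneg: "0 \<le> \<rho> z" if "0 \<le> z" "z \<le> 1" for z
    using that assms t2 by (auto simp: \<rho>_def power_le_one)
  have \<rho>_sq: "(\<rho> z)\<^sup>2 = (if z \<le> t then (1 / t\<^sup>2 - 1) * z\<^sup>2 else 1 - z\<^sup>2)" if "0 \<le> z" "z \<le> 1" for z
    using that assms t2 by (auto simp: \<rho>_def power_le_one power_mult_distrib power_divide field_simps)
  have in_S: "g f \<in> ?S \<longleftrightarrow> f e \<in> {0..1} \<and> sqrt (\<Sum>b\<in>A. (f b)\<^sup>2) \<le> \<rho> (f e)" for f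
  proof -
    \<comment> \<open>Height along the axis and squared distance from the axis; after squaring, the
      ball and the cone each give an upper bound on \<open>s\<close>.\<close>
    define z s where "z = f e" and "s = (\<Sum>b\<in>A. (f b)\<^sup>2)"
    have s: "0 \<le> s" by (simp add: s_def sum_nonneg)
    have "(\<Sum>b\<in>Basis. (f b)\<^sup>2) = z\<^sup>2 + s"
      using A(1,2) by (subst A(3)) (simp add: z_def s_def)
    then have "norm (g f) = sqrt (z\<^sup>2 + s)"
      by (simp add: g_norm)
    then have "g f \<in> ?S \<longleftrightarrow> sqrt (z\<^sup>2 + s) \<le> 1 \<and> t * sqrt (z\<^sup>2 + s) \<le> z"
      using assms by (simp add: g_inner z_def)
    also have "\<dots> \<longleftrightarrow> z\<^sup>2 + s \<le> 1 \<and> 0 \<le> z \<and> t\<^sup>2 * (z\<^sup>2 + s) \<le> z\<^sup>2"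
    proof -
      have "t * sqrt (z\<^sup>2 + s) \<le> z \<longleftrightarrow> 0 \<le> z \<and> t\<^sup>2 * (z\<^sup>2 + s) \<le> z\<^sup>2"
      proof (cases "0 \<le> z")
        case True
        then have "t * sqrt (z\<^sup>2 + s) \<le> z \<longleftrightarrow> (t * sqrt (z\<^sup>2 + s))\<^sup>2 \<le> z\<^sup>2"
          using assms s by (intro power_mono_iff[symmetric]) auto
        with True s show ?thesis by (simp add: power_mult_distrib)
      next
        case False
        then have "0 \<le> t * sqrt (z\<^sup>2 + s)" using assms s by auto
        with False show ?thesis by linarith
      qed
      then show ?thesis by simp
    qed
    also have "\<dots> \<longleftrightarrow> z \<in> {0..1} \<and> s \<le> (\<rho> z)\<^sup>2"
    proof (cases "z \<in> {0..1}")
      case False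
      have "z \<le> 1" if "z\<^sup>2 + s \<le> 1"
        using that s abs_square_le_1[of z] by linarith
      with False show ?thesis by auto
    next
      case True
      have t0: "0 < t\<^sup>2" using assms by simp
      have eq: "t\<^sup>2 * (z\<^sup>2 + s) \<le> z\<^sup>2 \<longleftrightarrow> s \<le> (1 / t\<^sup>2 - 1) * z\<^sup>2"
        using t0 by (simp add: field_simps)
      \<comment> \<open>The bound from the cone is the stricter one exactly up to height
        \<open>t\<close>, where the cone meets the sphere; this is the case split in
        \<open>\<rho>\<close>.\<close>
      have le: "(1 / t\<^sup>2 - 1) * z\<^sup>2 \<le> 1 - z\<^sup>2 \<longleftrightarrow> z \<le> t"
      proof -
        have "(1 / t\<^sup>2 - 1) * z\<^sup>2 \<le> 1 - z\<^sup>2 \<longleftrightarrow> z\<^sup>2 \<le> t\<^sup>2"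
          using t0 by (simp add: field_simps)
        also have "\<dots> \<longleftrightarrow> z \<le> t" using assms True by (intro power_mono_iff) auto
        finally show ?thesis .
      qed
      have "(z\<^sup>2 + s \<le> 1 \<and> 0 \<le> z \<and> t\<^sup>2 * (z\<^sup>2 + s) \<le> z\<^sup>2) \<longleftrightarrow>
        s \<le> 1 - z\<^sup>2 \<and> s \<le> (1 / t\<^sup>2 - 1) * z\<^sup>2"
        unfolding eq using True by auto
      also have "\<dots> \<longleftrightarrow> s \<le> (if z \<le> t then (1 / t\<^sup>2 - 1) * z\<^sup>2 else 1 - z\<^sup>2)"
        unfolding le[symmetric] by auto
      finally show ?thesis using True \<rho>_sq[of z] by simp
    qed
    also have "\<dots> \<longleftrightarrow> z \<in> {0..1} \<and> sqrt s \<le> \<rho> z"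
      using real_sqrt_le_iff'[OF s \<rho>_nonneg[of z]] by auto
    finally show ?thesis by (simp add: z_def s_def)
  qed
  have S[measurable]: "?S \<in> sets borel"
    by measurable
  have "emeasure lborel ?S = (\<integral>\<^sup>+x. indicator ?S x \<partial>distr (Pi\<^sub>M Basis (\<lambda>_. lborel)) borel g)"
    by (simp add: g_def flip: lborel_eq)
  also have "\<dots> = (\<integral>\<^sup>+f. indicator ?S (g f) \<partial>Pi\<^sub>M Basis (\<lambda>_. lborel))"
    by (rule nn_integral_distr) auto
  \<comment> \<open>Tonelli, with the axis coordinate as the outer variable.\<close>
  also have "\<dots> = (\<integral>\<^sup>+z. (\<integral>\<^sup>+f. indicator ?S (g (f(e := z))) \<partial>Pi\<^sub>M A (\<lambda>_. lborel)) \<partial>lborel)"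
    unfolding A(3) using A g_meas by (subst product_nn_integral_insert_rev) (auto simp flip: A(3))
  also have "\<dots> = (\<integral>\<^sup>+z. ennreal (pi * (\<rho> z)\<^sup>2) * indicator {0..1} z \<partial>lborel)"
  proof (intro nn_integral_cong)
    fix z :: real
    let ?D = "{f. sqrt (\<Sum>i\<in>A. (f i)\<^sup>2) \<le> \<rho> z} \<inter> space (Pi\<^sub>M A (\<lambda>_. lborel))"
    have "(\<Sum>b\<in>A. (if b = e then z else f b)\<^sup>2) = (\<Sum>b\<in>A. (f b)\<^sup>2)" for f
      using A by (intro sum.cong) auto
    then have "(\<integral>\<^sup>+f. indicator ?S (g (f(e := z))) \<partial>Pi\<^sub>M A (\<lambda>_. lborel)) =
      (\<integral>\<^sup>+f. indicator {0..1} z * indicator ?D f \<partial>Pi\<^sub>M A (\<lambda>_. lborel))"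
      unfolding indicator_def of_bool_def in_S by (intro nn_integral_cong) auto
    also have "\<dots> = indicator {0..1} z * emeasure (Pi\<^sub>M A (\<lambda>_. lborel)) ?D"
      using A by (subst nn_integral_cmult) (auto intro!: nn_integral_indicator)
    also have "\<dots> = ennreal (pi * (\<rho> z)\<^sup>2) * indicator {0..1} z"
      using emeasure_disc[OF A(4), of "\<rho> z"] \<rho>_nonneg[of z] by (auto simp: indicator_def)
    finally show "(\<integral>\<^sup>+f. indicator ?S (g (f(e := z))) \<partial>Pi\<^sub>M A (\<lambda>_. lborel)) =
      ennreal (pi * (\<rho> z)\<^sup>2) * indicator {0..1} z" .
  qed
  \<comment> \<open>The two closed intervals overlap only in the null set \<open>{t}\<close>, so
    each piece can be integrated by the fundamental theorem of calculus.\<close>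
  also have "\<dots> = (\<integral>\<^sup>+z. ennreal (pi * (1 / t\<^sup>2 - 1) * z\<^sup>2) * indicator {0..t} z +
    ennreal (pi * (1 - z\<^sup>2)) * indicator {t..1} z \<partial>lborel)"
  proof (intro nn_integral_cong_AE)
    have "AE z in lborel. z \<noteq> t" by (rule AE_lborel_singleton)
    then show "AE z in lborel. ennreal (pi * (\<rho> z)\<^sup>2) * indicator {0..1} z =
      ennreal (pi * (1 / t\<^sup>2 - 1) * z\<^sup>2) * indicator {0..t} z + ennreal (pi * (1 - z\<^sup>2)) * indicator {t..1} z"
      by eventually_elim (use assms in \<open>auto simp: indicator_def \<rho>_sq mult.assoc\<close>)
  qed
  also have "\<dots> = (\<integral>\<^sup>+z. ennreal (pi * (1 / t\<^sup>2 - 1) * z\<^sup>2) * indicator {0..t} z \<partial>lborel) +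
    (\<integral>\<^sup>+z. ennreal (pi * (1 - z\<^sup>2)) * indicator {t..1} z \<partial>lborel)"
    by (rule nn_integral_add) auto
  also have "(\<integral>\<^sup>+z. ennreal (pi * (1 / t\<^sup>2 - 1) * z\<^sup>2) * indicator {0..t} z \<partial>lborel) =
    ennreal (pi * (1 / t\<^sup>2 - 1) * t ^ 3 / 3 - pi * (1 / t\<^sup>2 - 1) * 0 ^ 3 / 3)"
    using assms t2
    by (intro nn_integral_FTC_Icc) (auto intro!: derivative_eq_intros mult_nonneg_nonneg)
  also have "(\<integral>\<^sup>+z. ennreal (pi * (1 - z\<^sup>2)) * indicator {t..1} z \<partial>lborel) =
    ennreal (pi * (1 - 1 ^ 3 / 3) - pi * (t - t ^ 3 / 3))"
    using assms t2
    by (intro nn_integral_FTC_Icc) (auto intro!: derivative_eq_intros simp: power_le_one)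
  also have "ennreal (pi * (1 / t\<^sup>2 - 1) * t ^ 3 / 3 - pi * (1 / t\<^sup>2 - 1) * 0 ^ 3 / 3) +
    ennreal (pi * (1 - 1 ^ 3 / 3) - pi * (t - t ^ 3 / 3)) =
    ennreal ((pi * (1 / t\<^sup>2 - 1) * t ^ 3 / 3) + (pi * (1 - 1 ^ 3 / 3) - pi * (t - t ^ 3 / 3)))"
  proof -
    \<comment> \<open>Adding under \<open>ennreal\<close> requires nonnegative summands; the second
      one is \<open>pi * (1 - t)\<^sup>2 * (2 + t) / 3\<close>.\<close>
    have "0 \<le> (1 - t)\<^sup>2 * (2 + t)" using assms by simp
    then have "t - t ^ 3 / 3 \<le> 2 / 3" by (simp add: power2_eq_square power3_eq_cube algebra_simps)
    then have "pi * (t - t ^ 3 / 3) \<le> pi * (2 / 3)" by (intro mult_left_mono) auto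
    moreover have "0 \<le> pi * (1 / t\<^sup>2 - 1) * t ^ 3 / 3"
      using assms t2 by (auto intro!: mult_nonneg_nonneg)
    ultimately show ?thesis by (simp add: ennreal_plus)
  qed
  also have "(pi * (1 / t\<^sup>2 - 1) * t ^ 3 / 3) + (pi * (1 - 1 ^ 3 / 3) - pi * (t - t ^ 3 / 3)) =
    2 / 3 * pi * (1 - t)"
    using assms by (simp add: field_simps power2_eq_square power3_eq_cube)
  finally show ?thesis .
qed

text \<open>Rotation invariance: an orthogonal map takes a basis vector to \<open>u\<close>, and the
  sector about the one to the sector about the other.\<close>

lemma measure_spherical_sector:
  fixes u :: "real^3"
  assumes "norm u = 1" "0 < t" "t \<le> 1"
  shows "measure lborel {x \<in> cball 0 1. t * norm x \<le> x \<bullet> u} = 2 / 3 * pi * (1 - t)"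
proof -
  define e :: "real^3" where "e = axis 1 1"
  have e: "e \<in> Basis" "norm e = 1" by (auto simp: e_def axis_in_Basis_iff norm_axis_1)
  obtain f where f: "orthogonal_transformation f" "f e = u"
    using orthogonal_transformation_exists_1[OF e(2) assms(1)] by metis
  let ?S = "\<lambda>u. {x :: real^3. x \<in> cball 0 1 \<and> t * norm x \<le> x \<bullet> u}"
  have S[measurable]: "?S v \<in> sets borel" for v by measurable
  have "f y \<bullet> u = y \<bullet> e" "norm (f y) = norm y" for y
    using f orthogonal_transformation_norm[OF f(1)] by (auto simp: orthogonal_transformation_def)
  then have "f y \<in> ?S u \<longleftrightarrow> f y \<in> f ` ?S e" for y
    using orthogonal_transformation_inj[OF f(1)] by (simp add: inj_image_mem_iff)
  then have eq: "?S u = f ` ?S e"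
    using orthogonal_transformation_surj[OF f(1)] by (metis (no_types, lifting) set_eqI surj_def)
  have lm: "?S e \<in> lmeasurable"
  proof (rule bounded_set_imp_lmeasurable)
    show "bounded (?S e)" by (rule bounded_subset[OF bounded_cball[of 0 1]]) auto
  qed auto
  \<comment> \<open>Invariance under orthogonal maps is applied to \<open>lebesgue\<close>, which
    agrees with \<open>lborel\<close> on Borel sets.\<close>
  have "measure lborel (?S u) = measure lebesgue (?S u)" by simp
  also have "\<dots> = measure lebesgue (?S e)"
    unfolding eq by (rule measure_orthogonal_image[OF f(1) lm])
  also have "\<dots> = measure lborel (?S e)" by simp
  also have "\<dots> = 2 / 3 * pi * (1 - t)"
    using emeasure_spherical_sector_Basis[OF _ e(1), of t] assms by (simp add: measure_def)
  finally show ?thesis .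
qed

section \<open>Central angles and the uniform distribution on the sphere\<close>

text \<open>Cauchy-Schwarz; if \<open>x\<close> or \<open>y\<close> equals \<open>c\<close>, the
  quotient is 0 by the convention for division by zero, so the bounds hold there too.\<close>

lemma central_angle_arg_bounds:
  "- 1 \<le> ((x - c) \<bullet> (y - c)) / (norm (x - c) * norm (y - c))"
  "((x - c) \<bullet> (y - c)) / (norm (x - c) * norm (y - c)) \<le> 1"
proof -
  have "\<bar>((x - c) \<bullet> (y - c)) / (norm (x - c) * norm (y - c))\<bar> \<le> 1"
    using Cauchy_Schwarz_ineq2[of "x - c" "y - c"] by (auto simp: divide_le_eq_1 zero_less_mult_iff)
  then show "- 1 \<le> ((x - c) \<bullet> (y - c)) / (norm (x - c) * norm (y - c))"
    "((x - c) \<bullet> (y - c)) / (norm (x - c) * norm (y - c)) \<le> 1"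
    by linarith+
qed

lemma central_angle_bounds: "0 \<le> central_angle c x y" "central_angle c x y \<le> pi"
  unfolding central_angle_def
  by (rule arccos_lbound arccos_ubound; rule central_angle_arg_bounds)+

lemma cos_central_angle:
  "cos (central_angle c x y) = ((x - c) \<bullet> (y - c)) / (norm (x - c) * norm (y - c))"
  unfolding central_angle_def by (rule cos_arccos; rule central_angle_arg_bounds)

text \<open>Cosine decreases on \<open>{0..pi}\<close>; this trades \<open>arccos\<close> for an
  inequality between inner product and norms.\<close>

lemma central_angle_le_iff:
  assumes "0 \<le> a" "a \<le> pi"
  shows "central_angle c x y \<le> a \<longleftrightarrow> cos a \<le> ((x - c) \<bullet> (y - c)) / (norm (x - c) * norm (y - c))"
  using cos_mono_le_eq[OF assms central_angle_bounds] by (simp flip: cos_central_angle)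

text \<open>Sublevel sets avoid any appeal to \<open>arccos\<close> outside its natural domain: they
  are empty below 0, everything above \<open>pi\<close>, and described by the cosine in
  between.\<close>

lemma borel_measurable_central_angle[measurable]: "(\<lambda>x. central_angle c x y) \<in> borel_measurable borel"
proof (rule borel_measurableI_le)
  fix a
  consider "a < 0" | "0 \<le> a" "a \<le> pi" | "pi < a" by linarith
  then show "{x \<in> space borel. central_angle c x y \<le> a} \<in> sets borel"
  proof cases
    case 1
    then have "\<not> central_angle c x y \<le> a" for x
      using central_angle_bounds(1)[of c x y] by linarith
    then show ?thesis by simp
  next
    case 2
    then show ?thesis by (simp add: central_angle_le_iff)
  next
    case 3
    then have "central_angle c x y \<le> a" for x
      using central_angle_bounds(2)[of c x y] by linarith
    then show ?thesis by simp
  qed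
qed

text \<open>The law of cosines in the triangle with vertices \<open>c\<close>, \<open>x\<close> and
  \<open>y\<close>.\<close>

lemma dist_eq_r_of_angle:
  assumes "0 < norm (x - c)" "0 < norm (y - c)"
  shows "dist x y = r_of_angle (norm (x - c)) (norm (y - c)) (central_angle c x y)"
proof -
  have "(dist x y)\<^sup>2 = ((x - c) - (y - c)) \<bullet> ((x - c) - (y - c))"
    by (simp add: dist_norm power2_norm_eq_inner)
  also have "\<dots> = (norm (x - c))\<^sup>2 + (norm (y - c))\<^sup>2 - 2 * ((x - c) \<bullet> (y - c))"
    unfolding inner_diff_left[of "x - c"] inner_diff_right[of _ "x - c"]
    by (simp add: power2_norm_eq_inner inner_commute[of "y - c" "x - c"])
  also have "(x - c) \<bullet> (y - c) = norm (x - c) * norm (y - c) * cos (central_angle c x y)"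
    using assms by (simp add: cos_central_angle)
  finally show ?thesis
    unfolding r_of_angle_def by (intro real_sqrt_unique[symmetric]) auto
qed

section \<open>Radial projection and the area of spherical caps\<close>

lemma borel_measurable_sphere_projection[measurable]:
  "(\<lambda>x :: real^3. c + (R / norm x) *\<^sub>R x) \<in> borel_measurable borel"
  by measurable

text \<open>The radial projection sends 0 to the centre \<open>c\<close>, off the sphere, so this
  point has to be discarded as a null set.\<close>

lemma AE_unit_cball_nonzero: "AE x :: real^3 in uniform_measure lborel (cball 0 1). x \<noteq> 0"
  by (rule AE_uniform_measureI) (auto intro: AE_lborel_singleton AE_mp)

lemma AE_uniform_sphere_norm:
  assumes "0 < R"
  shows "AE x in uniform_sphere c R. norm (x - c) = R"
proof -
  have "AE x :: real^3 in uniform_measure lborel (cball 0 1). norm (c + (R / norm x) *\<^sub>R x - c) = R"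
    using AE_unit_cball_nonzero by eventually_elim (use assms in simp)
  then show ?thesis
    unfolding uniform_sphere_def by (subst AE_distr_iff) auto
qed

text \<open>The preimage of the cap under the radial projection is, up to the origin, a solid sector
  of the unit ball, so its probability is a quotient of volumes. The bound \<open>a < pi / 2\<close>
  makes \<open>cos a\<close> positive, as the sector formula assumes.\<close>

lemma measure_uniform_sphere_cap:
  assumes R: "0 < R" and u: "u \<noteq> c" and a: "0 \<le> a" "a < pi / 2"
  shows "measure (uniform_sphere c R) {x. central_angle c x u \<le> a} = (1 - cos a) / 2"
proof -
  define v where "v = (u - c) /\<^sub>R norm (u - c)"
  define K where "K = uniform_measure lborel (cball (0::real^3) 1)"
  define S where "S = {x :: real^3. x \<in> cball 0 1 \<and> cos a * norm x \<le> x \<bullet> v}"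
  have v: "norm v = 1" using u by (simp add: v_def)
  have inner_v: "x \<bullet> v = x \<bullet> (u - c) / norm (u - c)" for x
    by (simp add: v_def divide_inverse)
  have cosa: "0 < cos a" "cos a \<le> 1" using a by (auto intro!: cos_gt_zero_pi)
  have S[measurable]: "S \<in> sets borel" unfolding S_def by measurable
  have sets_K: "sets K = sets borel" by (simp add: K_def)
  have vol: "measure lborel (cball (0::real^3) 1) = 4 / 3 * pi"
    by (simp add: content_ball unit_ball_vol_3 content_cball)
  have "measure (uniform_sphere c R) {x. central_angle c x u \<le> a} =
    measure K {x. central_angle c (c + (R / norm x) *\<^sub>R x) u \<le> a}"
    unfolding uniform_sphere_def K_def by (subst measure_distr) (auto simp: vimage_def)
  \<comment> \<open>Scaling by the positive factor \<open>R / norm x\<close> leaves the angle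
    unchanged, so only the direction of \<open>x\<close> matters.\<close>
  also have "\<dots> = measure K {x. cos a * norm x \<le> x \<bullet> v}"
  proof (rule measure_eq_AE)
    have "AE x in K. x \<noteq> 0" unfolding K_def by (rule AE_unit_cball_nonzero)
    then show "AE x in K. x \<in> {x. central_angle c (c + (R / norm x) *\<^sub>R x) u \<le> a} \<longleftrightarrow>
      x \<in> {x. cos a * norm x \<le> x \<bullet> v}"
    proof eventually_elim
      case (elim x)
      have "central_angle c (c + (R / norm x) *\<^sub>R x) u \<le> a \<longleftrightarrow> cos a \<le> x \<bullet> v / norm x"
        using R a elim u pi_gt_zero by (subst central_angle_le_iff) (auto simp: inner_v mult.commute)
      with elim show ?case by (simp add: field_simps)
    qed
  qed (unfold sets_K, measurable)
  also have "\<dots> = measure lborel (cball 0 1 \<inter> {x. cos a * norm x \<le> x \<bullet> v}) / measure lborel (cball (0::real^3) 1)"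
    unfolding K_def by (intro measure_uniform_measure) (auto simp: emeasure_cball unit_ball_vol_3)
  also have "cball 0 1 \<inter> {x. cos a * norm x \<le> x \<bullet> v} = {x \<in> cball 0 1. cos a * norm x \<le> x \<bullet> v}"
    by auto
  also have "measure lborel \<dots> / measure lborel (cball (0::real^3) 1) = (1 - cos a) / 2"
    unfolding vol measure_spherical_sector[OF v cosa] by simp
  finally show ?thesis .
qed

section \<open>The associated leader\<close>

lemma associated_leader_nearest:
  assumes "1 \<le> N"
  shows "associated_leader N user x < N" "i < N \<Longrightarrow> r_LU N user x \<le> dist (x i) user"
  using arg_min_if_finite(1)[of "{..<N}" "\<lambda>i. dist (x i) user"]
    arg_min_least[of "{..<N}" i "\<lambda>i. dist (x i) user"] assms
  by (auto simp: associated_leader_def r_LU_def lessThan_empty_iff)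

text \<open>The arg min is a choice from a predicate, so it suffices that the predicates coincide.
  This permits replacing the leader family by its restriction to \<open>{..<N}\<close>, a point of
  the product space.\<close>

lemma associated_leader_cong:
  assumes "\<And>i. i < N \<Longrightarrow> x i = y i"
  shows "associated_leader N user x = associated_leader N user y"
proof -
  have "is_arg_min (\<lambda>i. dist (x i) user) (\<lambda>i. i \<in> {..<N}) = is_arg_min (\<lambda>i. dist (y i) user) (\<lambda>i. i \<in> {..<N})"
    using assms by (auto simp: fun_eq_iff is_arg_min_linorder)
  then show ?thesis
    by (simp add: associated_leader_def arg_min_on_def arg_min_def)
qed

text \<open>The set of nearest leaders takes finitely many values, and it determines the choice.\<close>
lemma measurable_associated_leader[measurable]:
  assumes "1 \<le> N"
  shows "associated_leader N user \<in> measurable (Pi\<^sub>M {..<N} (\<lambda>_. borel)) (count_space {..<N})"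
proof (rule measurable_count_space_eq2[THEN iffD2], safe)
  let ?P = "Pi\<^sub>M {..<N} (\<lambda>_. borel :: (real^3) measure)"
  define D where "D = (\<lambda>x. {i. i < N \<and> (\<forall>j<N. dist (x i) user \<le> dist (x j :: real^3) user)})"
  fix k
  have leader: "associated_leader N user x = (SOME i. i \<in> D x)" for x
    by (simp add: associated_leader_def arg_min_on_def arg_min_def is_arg_min_linorder D_def Ball_def)
  have D: "{x \<in> space ?P. D x = S} \<in> sets ?P" if "S \<subseteq> {..<N}" for S
  proof -
    \<comment> \<open>For \<open>S\<close> inside \<open>{..<N}\<close> the equation is a finite
      conjunction of comparisons between distances.\<close>
    have "D x = S \<longleftrightarrow> (\<forall>i\<in>{..<N}. (i \<in> S) = (\<forall>j\<in>{..<N}. dist (x i) user \<le> dist (x j) user))" for x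
      using that by (auto simp: D_def)
    moreover have "Measurable.pred ?P (\<lambda>x. \<forall>i\<in>{..<N}. (i \<in> S) = (\<forall>j\<in>{..<N}. dist (x i) user \<le> dist (x j) user))"
    proof (intro pred_intros_finite)
      fix i assume i: "i \<in> {..<N}"
      have "Measurable.pred ?P (\<lambda>x. \<forall>j\<in>{..<N}. dist (x i) user \<le> dist (x j) user)"
      proof (intro pred_intros_finite)
        fix j assume j: "j \<in> {..<N}"
        have "(\<lambda>x. dist (x k) user) \<in> borel_measurable ?P" if "k \<in> {..<N}" for k
          using that by (intro borel_measurable_dist measurable_component_singleton) auto
        from borel_measurable_le[OF this[OF i] this[OF j]]
        show "Measurable.pred ?P (\<lambda>x. dist (x i) user \<le> dist (x j) user)" by (simp add: pred_def)
      qed auto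
      then show "Measurable.pred ?P (\<lambda>x. (i \<in> S) = (\<forall>j\<in>{..<N}. dist (x i) user \<le> dist (x j) user))"
        by (cases "i \<in> S") (simp_all only: simp_thms pred_intros_logic)
    qed auto
    ultimately show ?thesis by (simp add: pred_def)
  qed
  have "associated_leader N user -` {k} \<inter> space ?P =
    (\<Union>S\<in>{S. S \<subseteq> {..<N} \<and> (SOME i. i \<in> S) = k}. {x \<in> space ?P. D x = S})"
    unfolding vimage_def leader by (auto simp: D_def)
  also have "\<dots> \<in> sets ?P"
    using D by (intro sets.finite_UN) auto
  finally show "associated_leader N user -` {k} \<inter> space ?P \<in> sets ?P" .
qed (use associated_leader_nearest(1)[OF assms] in auto)

text \<open>The leader's index takes countably many values, so measurability need only be checked
  for each fixed index.\<close>

lemma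
  assumes "1 \<le> N"
  shows borel_measurable_theta_LU: "theta_LU c N user \<in> borel_measurable (Pi\<^sub>M {..<N} (\<lambda>_. borel))"
    and borel_measurable_r_LU: "r_LU N user \<in> borel_measurable (Pi\<^sub>M {..<N} (\<lambda>_. borel))"
proof -
  have comp: "(\<lambda>x. x i) \<in> measurable (Pi\<^sub>M {..<N} (\<lambda>_. borel)) (borel :: (real^3) measure)" if "i \<in> {..<N}" for i
    using that by (rule measurable_component_singleton)
  show "theta_LU c N user \<in> borel_measurable (Pi\<^sub>M {..<N} (\<lambda>_. borel))"
    unfolding theta_LU_def
  proof (rule measurable_compose_countable'[OF _ measurable_associated_leader[OF assms]])
    show "(\<lambda>x. central_angle c (x i) user) \<in> borel_measurable (Pi\<^sub>M {..<N} (\<lambda>_. borel))" if "i \<in> {..<N}" for i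
      by (rule measurable_compose[OF comp[OF that] borel_measurable_central_angle])
  qed auto
  show "r_LU N user \<in> borel_measurable (Pi\<^sub>M {..<N} (\<lambda>_. borel))"
    unfolding r_LU_def
  proof (rule measurable_compose_countable'[OF _ measurable_associated_leader[OF assms]])
    show "(\<lambda>x. dist (x i) user) \<in> borel_measurable (Pi\<^sub>M {..<N} (\<lambda>_. borel))" if "i \<in> {..<N}" for i
      by (rule borel_measurable_dist[OF comp[OF that]]) simp
  qed auto
qed

section \<open>Smallest distance and smallest angle\<close>

lemma theta_LU_bounds: "0 \<le> theta_LU c N user x" "theta_LU c N user x \<le> pi"
  by (simp_all add: theta_LU_def central_angle_bounds)

lemma r_LU_eq_r_of_angle:
  assumes "1 \<le> N" "\<And>i. i < N \<Longrightarrow> norm (x i - c) = Rsat" "0 < Rsat" "norm (user - c) = R0" "0 < R0"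
  shows "r_LU N user x = r_of_angle Rsat R0 (theta_LU c N user x)"
  using dist_eq_r_of_angle[of "x (associated_leader N user x)" c user] associated_leader_nearest(1)[of N user x] assms
  by (simp add: r_LU_def theta_LU_def)

text \<open>For leaders on a common sphere the distance to the user increases strictly with the
  angle, so the nearest leader also has the smallest angle.\<close>

lemma theta_LU_le_iff:
  assumes N: "1 \<le> N" and x: "\<And>i. i < N \<Longrightarrow> norm (x i - c) = Rsat" "0 < Rsat"
    and user: "norm (user - c) = R0" "0 < R0"
  shows "theta_LU c N user x \<le> a \<longleftrightarrow> (\<exists>i<N. central_angle c (x i) user \<le> a)"
proof -
  have "theta_LU c N user x \<le> central_angle c (x i) user" if i: "i < N" for i
  proof -
    have "r_of_angle Rsat R0 (theta_LU c N user x) \<le> r_of_angle Rsat R0 (central_angle c (x i) user)"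
      using associated_leader_nearest(2)[OF N i, of user x] r_LU_eq_r_of_angle[of N x c Rsat user R0]
        dist_eq_r_of_angle[of "x i" c user] assms i by simp
    then have "Rsat * R0 * cos (central_angle c (x i) user) \<le> Rsat * R0 * cos (theta_LU c N user x)"
      by (simp add: r_of_angle_def)
    then have "cos (central_angle c (x i) user) \<le> cos (theta_LU c N user x)"
      using x user by simp
    then show ?thesis
      using cos_mono_le_eq[OF central_angle_bounds theta_LU_bounds] by simp
  qed
  then show ?thesis
    using associated_leader_nearest(1)[OF N, of user x] by (auto simp: theta_LU_def intro: order_trans)
qed

lemma theta_LU_cong:
  assumes "1 \<le> N" "\<And>i. i < N \<Longrightarrow> x i = y i"
  shows "theta_LU c N user x = theta_LU c N user y"
  using associated_leader_cong[of N x y user] associated_leader_nearest(1)[of N user y] assms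
  by (simp add: theta_LU_def)

lemma r_LU_cong:
  assumes "1 \<le> N" "\<And>i. i < N \<Longrightarrow> x i = y i"
  shows "r_LU N user x = r_LU N user y"
  using associated_leader_cong[of N x y user] associated_leader_nearest(1)[of N user y] assms
  by (simp add: r_LU_def)

section \<open>Distribution of the nearest angle\<close>

lemma f_theta_LU_nonneg: "0 \<le> \<theta> \<Longrightarrow> \<theta> \<le> pi \<Longrightarrow> 0 \<le> f_theta_LU n \<theta>"
proof -
  assume \<theta>: "0 \<le> \<theta>" "\<theta> \<le> pi"
  have "0 \<le> 1 + cos \<theta>" using cos_ge_minus_one[of \<theta>] by linarith
  then show ?thesis
    using sin_ge_zero[OF \<theta>] unfolding f_theta_LU_def
    by (intro mult_nonneg_nonneg divide_nonneg_nonneg zero_le_power) auto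
qed

lemma borel_measurable_f_theta_LU[measurable]: "f_theta_LU n \<in> borel_measurable borel"
  unfolding f_theta_LU_def[abs_def] by measurable

text \<open>\<open>- ((1 + cos \<theta>) / 2) ^ N\<close> is an antiderivative of the density, with
  value -1 at 0.\<close>

lemma nn_integral_f_theta_LU:
  assumes "0 \<le> a" "a \<le> pi"
  shows "(\<integral>\<^sup>+\<theta>. ennreal (f_theta_LU N \<theta>) * indicator {0..a} \<theta> \<partial>lborel) = ennreal (1 - ((1 + cos a) / 2) ^ N)"
proof -
  have "(\<integral>\<^sup>+\<theta>. ennreal (f_theta_LU N \<theta>) * indicator {0..a} \<theta> \<partial>lborel) =
    ennreal (- (((1 + cos a) / 2) ^ N) - - (((1 + cos 0) / 2) ^ N))"
    using assms f_theta_LU_nonneg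
    by (intro nn_integral_FTC_Icc) (auto intro!: derivative_eq_intros simp: f_theta_LU_def)
  then show ?thesis by simp
qed

text \<open>Collects the geometric half of the model; the fading enters through the assumptions of
  later lemmas.\<close>

locale leader_constellation = prob_space M for M :: "'w measure" +
  fixes c user :: "real^3" and Rsat R0 :: real and N :: nat and X :: "nat \<Rightarrow> 'w \<Rightarrow> real^3"
  assumes N: "1 \<le> N" and Rsat: "0 < Rsat" and R0: "0 < R0" and user: "norm (user - c) = R0"
    and indep_X: "indep_vars (\<lambda>_. borel) X {..<N}"
    and distr_X: "\<And>i. i < N \<Longrightarrow> distr M borel (X i) = uniform_sphere c Rsat"
begin

definition \<Theta> :: "'w \<Rightarrow> real" where "\<Theta> \<omega> = theta_LU c N user (\<lambda>i. X i \<omega>)"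

lemma measurable_X: "i < N \<Longrightarrow> X i \<in> borel_measurable M"
  using indep_X by (auto simp: indep_vars_def)

lemma measurable_constellation: "(\<lambda>\<omega>. \<lambda>i\<in>{..<N}. X i \<omega>) \<in> measurable M (Pi\<^sub>M {..<N} (\<lambda>_. borel))"
  using measurable_X by (intro measurable_restrict) auto

text \<open>The points of the product space over \<open>{..<N}\<close> are extensional functions, so
  measurability and independence are obtained through the restricted family.\<close>

lemma \<Theta>_eq_restrict: "\<Theta> \<omega> = theta_LU c N user (\<lambda>i\<in>{..<N}. X i \<omega>)"
  unfolding \<Theta>_def using N by (intro theta_LU_cong) auto

lemma measurable_\<Theta>[measurable]: "\<Theta> \<in> borel_measurable M"
  using measurable_compose[OF measurable_constellation borel_measurable_theta_LU[OF N]]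
  by (subst measurable_cong[OF \<Theta>_eq_restrict])

lemma measurable_r_LU[measurable]: "(\<lambda>\<omega>. r_LU N user (\<lambda>i. X i \<omega>)) \<in> borel_measurable M"
proof -
  have "r_LU N user (\<lambda>i. X i \<omega>) = r_LU N user (\<lambda>i\<in>{..<N}. X i \<omega>)" for \<omega>
    using N by (intro r_LU_cong) auto
  then show ?thesis
    using measurable_compose[OF measurable_constellation borel_measurable_r_LU[OF N]] by simp
qed

lemma \<Theta>_nonneg: "0 \<le> \<Theta> \<omega>"
  by (simp add: \<Theta>_def theta_LU_bounds)

text \<open>Only the laws of the positions are given, so the leaders lie on the sphere merely almost
  surely; finitely many null sets are combined.\<close>

lemma AE_norm_X: "AE \<omega> in M. \<forall>i<N. norm (X i \<omega> - c) = Rsat"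
proof -
  have "AE \<omega> in M. norm (X i \<omega> - c) = Rsat" if "i < N" for i
  proof (rule AE_distrD[OF measurable_X[OF that]])
    show "AE x in distr M borel (X i). norm (x - c) = Rsat"
      unfolding distr_X[OF that] by (rule AE_uniform_sphere_norm[OF Rsat])
  qed
  then have "AE \<omega> in M. \<forall>i\<in>{..<N}. norm (X i \<omega> - c) = Rsat"
    by (intro AE_finite_allI) auto
  then show ?thesis by (simp add: Ball_def)
qed

lemma AE_r_LU: "AE \<omega> in M. r_LU N user (\<lambda>i. X i \<omega>) = r_of_angle Rsat R0 (\<Theta> \<omega>)"
  using AE_norm_X
proof eventually_elim
  case (elim \<omega>)
  then show ?case
    using r_LU_eq_r_of_angle[of N "\<lambda>i. X i \<omega>" c Rsat user R0] N Rsat R0 user by (simp add: \<Theta>_def)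
qed

lemma prob_\<Theta>_le:
  assumes a: "0 \<le> a" "a < pi / 2"
  shows "prob {\<omega> \<in> space M. \<Theta> \<omega> \<le> a} = 1 - ((1 + cos a) / 2) ^ N"
proof -
  define A where "A = {x :: real^3. \<not> central_angle c x user \<le> a}"
  have A[measurable]: "A \<in> sets borel" unfolding A_def by measurable
  have preimage[measurable]: "X i -` A \<inter> space M \<in> events" if "i < N" for i
    using measurable_X[OF that] A by (rule measurable_sets)
  have "user \<noteq> c" using user R0 by auto
  have one: "prob (X i -` A \<inter> space M) = (1 + cos a) / 2" if "i < N" for i
  proof -
    interpret D: prob_space "distr M borel (X i)"
      using measurable_X[OF that] by (rule prob_space_distr)
    have "prob (X i -` A \<inter> space M) = measure (distr M borel (X i)) A"
      using measurable_X[OF that] by (simp add: measure_distr)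
    also have "\<dots> = D.prob (space (distr M borel (X i)) - {x. central_angle c x user \<le> a})"
      by (simp add: A_def Compl_eq_Diff_UNIV[symmetric] Collect_neg_eq)
    also have "\<dots> = 1 - D.prob {x. central_angle c x user \<le> a}"
      by (rule D.prob_compl) simp
    also have "\<dots> = (1 + cos a) / 2"
      using measure_uniform_sphere_cap[OF Rsat \<open>user \<noteq> c\<close> a] by (simp add: distr_X[OF that] field_simps)
    finally show ?thesis .
  qed
  \<comment> \<open>An intersection over the empty index set would not be the sure event.\<close>
  have ne: "{..<N} \<noteq> {}" using N by (auto simp: lessThan_empty_iff)
  \<comment> \<open>Passing to the complement turns the union over leaders into an intersection, to
    which independence applies: no leader lies in the cap.\<close>
  have "prob {\<omega> \<in> space M. \<Theta> \<omega> \<le> a} = prob (space M - (\<Inter>i\<in>{..<N}. X i -` A \<inter> space M))"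
  proof (rule measure_eq_AE)
    show "AE \<omega> in M. \<omega> \<in> {\<omega> \<in> space M. \<Theta> \<omega> \<le> a} \<longleftrightarrow> \<omega> \<in> space M - (\<Inter>i\<in>{..<N}. X i -` A \<inter> space M)"
      using AE_norm_X
    proof eventually_elim
      case (elim \<omega>)
      then have "\<Theta> \<omega> \<le> a \<longleftrightarrow> (\<exists>i<N. central_angle c (X i \<omega>) user \<le> a)"
        unfolding \<Theta>_def using theta_LU_le_iff[of N "\<lambda>i. X i \<omega>" c Rsat user R0 a] N Rsat R0 user by simp
      then show ?case using ne by (auto simp: A_def)
    qed
    show "space M - (\<Inter>i\<in>{..<N}. X i -` A \<inter> space M) \<in> events"
      using preimage ne by (intro sets.Diff sets.finite_INT) auto
  qed simp
  also have "\<dots> = 1 - prob (\<Inter>i\<in>{..<N}. X i -` A \<inter> space M)"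
    using preimage ne by (intro prob_compl sets.finite_INT) auto
  also have "prob (\<Inter>i\<in>{..<N}. X i -` A \<inter> space M) = (\<Prod>i\<in>{..<N}. prob (X i -` A \<inter> space M))"
    using ne A by (intro indep_varsD_finite[OF indep_X]) auto
  also have "\<dots> = ((1 + cos a) / 2) ^ N"
    by (simp add: one)
  finally show ?thesis .
qed

text \<open>The cap formula covers angles below \<open>pi / 2\<close>, so the law is identified only
  up to \<open>b\<close>. The restricted measures are finite but need not have mass 1, hence
  uniqueness of distribution functions is used for finite measures.\<close>

lemma distr_\<Theta>_restricted:
  assumes b: "0 \<le> b" "b < pi / 2"
  shows "density (distr M borel \<Theta>) (indicator {..b}) =
    density lborel (\<lambda>\<theta>. ennreal (f_theta_LU N \<theta>) * indicator {0..b} \<theta>)" (is "?D1 = ?D2")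
proof (rule cdf_unique')
  interpret D: prob_space "distr M borel \<Theta>"
    by (rule prob_space_distr) simp
  have D1: "emeasure ?D1 A = emeasure (distr M borel \<Theta>) ({..b} \<inter> A)" if [measurable]: "A \<in> sets borel" for A
  proof -
    have "emeasure ?D1 A = (\<integral>\<^sup>+\<theta>. indicator ({..b} \<inter> A) \<theta> \<partial>distr M borel \<Theta>)"
      unfolding indicator_inter_arith by (rule emeasure_density) auto
    also have "\<dots> = emeasure (distr M borel \<Theta>) ({..b} \<inter> A)"
      by (rule nn_integral_indicator) auto
    finally show ?thesis .
  qed
  have D2: "emeasure ?D2 A = (\<integral>\<^sup>+\<theta>. ennreal (f_theta_LU N \<theta>) * indicator ({0..b} \<inter> A) \<theta> \<partial>lborel)"
    if [measurable]: "A \<in> sets borel" for A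
    unfolding indicator_inter_arith mult.assoc[symmetric] by (rule emeasure_density) auto
  show "finite_borel_measure ?D1"
  proof -
    have "emeasure ?D1 UNIV = ennreal (D.prob ({..b} \<inter> UNIV))"
      using D1[of UNIV] by (simp only: D.emeasure_eq_measure borel_open[OF open_UNIV])
    then have "finite_measure ?D1" by (intro finite_measureI) simp
    then show ?thesis
      by (simp add: finite_borel_measure_def finite_borel_measure_axioms_def)
  qed
  show "finite_borel_measure ?D2"
  proof -
    have "b \<le> pi" using b pi_gt_zero by linarith
    then have "emeasure ?D2 UNIV = ennreal (1 - ((1 + cos b) / 2) ^ N)"
      using nn_integral_f_theta_LU[OF b(1), of N] by (simp add: D2)
    then have "finite_measure ?D2" by (intro finite_measureI) simp
    then show ?thesis
      by (simp add: finite_borel_measure_def finite_borel_measure_axioms_def)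
  qed
  have "emeasure ?D1 {..a} = emeasure ?D2 {..a}" for a
  proof -
    \<comment> \<open>Cutting at \<open>b\<close> keeps the threshold in the range where the
      distribution function is known.\<close>
    have "emeasure ?D1 {..a} = emeasure (distr M borel \<Theta>) {..min a b}"
      by (simp add: D1 min.commute)
    also have "\<dots> = ennreal (prob {\<omega> \<in> space M. \<Theta> \<omega> \<le> min a b})"
      by (subst emeasure_distr) (auto simp: emeasure_eq_measure vimage_def Int_def conj_commute)
    also have "\<dots> = emeasure ?D2 {..a}"
    proof (cases "0 \<le> a")
      case True
      with b have "{0..b} \<inter> {..a} = {0..min a b}" by auto
      moreover have "min a b < pi / 2" "min a b \<le> pi" "0 \<le> min a b" using True b pi_gt_zero by linarith+
      ultimately show ?thesis
        by (simp add: D2 prob_\<Theta>_le nn_integral_f_theta_LU del: min_less_iff_conj min.bounded_iff)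
    next
      case False
      \<comment> \<open>Below 0 both measures vanish, since angles are nonnegative.\<close>
      then have "\<not> \<Theta> \<omega> \<le> min a b" for \<omega> using \<Theta>_nonneg[of \<omega>] by linarith
      then have "prob {\<omega> \<in> space M. \<Theta> \<omega> \<le> min a b} = prob {}" by (intro arg_cong[where f = prob]) blast
      moreover from False have "{0..b} \<inter> {..a} = {}" by auto
      ultimately show ?thesis by (simp add: D2 del: min_less_iff_conj min.bounded_iff)
    qed
    finally show ?thesis .
  qed
  then show "cdf ?D1 = cdf ?D2"
    by (simp add: cdf_def measure_def fun_eq_iff)
qed

end

section \<open>The average rate\<close>

text \<open>With \<open>a \<le> k * b\<close>, Bernoulli's inequality gives
  \<open>1 + a * w \<le> (1 + b * w) ^ k\<close>; then take logarithms.\<close>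

lemma ln_one_plus_le_mult:
  fixes a b :: real
  assumes "0 < a" "0 < b"
  obtains k :: nat where "\<And>w. 0 \<le> w \<Longrightarrow> ln (1 + a * w) \<le> real k * ln (1 + b * w)"
proof -
  obtain k :: nat where k: "a \<le> real k * b"
    using real_arch_simple[of "a / b"] assms by (auto simp: field_simps)
  have "ln (1 + a * w) \<le> real k * ln (1 + b * w)" if w: "0 \<le> w" for w
  proof -
    have pos: "0 < 1 + b * w" "0 < 1 + a * w" using assms w by (simp_all add: add_pos_nonneg)
    have "1 + a * w \<le> 1 + real k * (b * w)"
      using mult_right_mono[OF k w] by (simp add: mult.assoc)
    also have "\<dots> \<le> (1 + b * w) ^ k"
      using assms w by (intro Bernoulli_inequality) (simp add: order_trans[of _ 0])
    finally have "ln (1 + a * w) \<le> ln ((1 + b * w) ^ k)"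
      using pos by (subst ln_le_cancel_iff) auto
    then show ?thesis using pos by (simp add: ln_realpow)
  qed
  then show ?thesis by (rule that)
qed

text \<open>Integrability of the rate in the fading does not depend on the leader distance, so either all
  conditional rates are finite or all of them are infinite (and the integrals below then are 0).\<close>
lemma integrable_log_one_plus_mult:
  fixes P :: "real measure"
  assumes sets: "sets P = sets borel" and nonneg: "AE w in P. 0 \<le> w" and ab: "0 < a" "0 < b"
    and int: "integrable P (\<lambda>w. log 2 (1 + b * w))"
  shows "integrable P (\<lambda>w. log 2 (1 + a * w))"
proof -
  note sets[measurable_cong]
  obtain k :: nat where k: "\<And>w. 0 \<le> w \<Longrightarrow> ln (1 + a * w) \<le> real k * ln (1 + b * w)"
    using ln_one_plus_le_mult[OF ab] by blast
  show ?thesis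
  proof (rule Bochner_Integration.integrable_bound)
    show "integrable P (\<lambda>w. real k * log 2 (1 + b * w))"
      using int by (rule integrable_mult_right)
    show "AE w in P. norm (log 2 (1 + a * w)) \<le> norm (real k * log 2 (1 + b * w))"
      using nonneg
    proof eventually_elim
      case (elim w)
      then have "0 \<le> ln (1 + a * w)" using ab by simp
      with k[OF elim] show ?case
        by (simp add: log_def divide_right_mono)
    qed
  qed measurable
qed

lemma r_of_angle_sq:
  "(r_of_angle R R0 \<theta>)\<^sup>2 = R\<^sup>2 + R0\<^sup>2 - 2 * R * R0 * cos \<theta>" if "0 < R" "0 < R0"
proof -
  have "R * R0 * cos \<theta> \<le> R * R0 * 1" using that by (intro mult_left_mono) auto
  moreover have "0 \<le> (R - R0)\<^sup>2" by simp
  ultimately have "0 \<le> R\<^sup>2 + R0\<^sup>2 - 2 * R * R0 * cos \<theta>" by (simp add: power2_diff)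
  then show ?thesis by (simp add: r_of_angle_def)
qed

text \<open>The smallest distance is the altitude, attained at angle 0. This bounds the SNR per unit
  of fading uniformly in the angle.\<close>

lemma r_of_angle_sq_ge:
  assumes "0 < R" "0 < R0"
  shows "(R - R0)\<^sup>2 \<le> (r_of_angle R R0 \<theta>)\<^sup>2"
proof -
  have "R * R0 * cos \<theta> \<le> R * R0 * 1" using assms by (intro mult_left_mono) auto
  then show ?thesis by (simp add: r_of_angle_sq[OF assms] power2_diff)
qed

lemma borel_measurable_r_of_angle[measurable]: "r_of_angle R R0 \<in> borel_measurable borel"
  unfolding r_of_angle_def[abs_def] by measurable

section \<open>Independence of angle and fading, and Fubini's theorem\<close>

context leader_constellation
begin

text \<open>The nearest angle is a measurable function of the constellation, so its sigma-algebra is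
  contained in the one generated by the leaders and inherits the independence.\<close>

lemma indep_var_\<Theta>:
  assumes W[measurable]: "W \<in> borel_measurable M"
    and indep: "indep_set (sets (vimage_algebra (space M) W borel))
      (sets (vimage_algebra (space M) (\<lambda>\<omega>. \<lambda>i\<in>{..<N}. X i \<omega>) (Pi\<^sub>M {..<N} (\<lambda>_. borel))))"
  shows "indep_var borel \<Theta> borel W"
  unfolding indep_var_eq
proof (intro conjI)
  let ?V = "vimage_algebra (space M) (\<lambda>\<omega>. \<lambda>i\<in>{..<N}. X i \<omega>) (Pi\<^sub>M {..<N} (\<lambda>_. borel))"
  let ?V' = "vimage_algebra (space M) \<Theta> borel" and ?W = "vimage_algebra (space M) W borel"
  have "(\<lambda>\<omega>. \<lambda>i\<in>{..<N}. X i \<omega>) \<in> measurable ?V (Pi\<^sub>M {..<N} (\<lambda>_. borel))"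
    by (rule measurable_vimage_algebra1) (auto simp: space_PiM)
  from measurable_compose[OF this borel_measurable_theta_LU[OF N]]
  have "\<Theta> \<in> borel_measurable ?V"
    by (simp add: \<Theta>_eq_restrict[abs_def])
  then have "sets ?V' \<subseteq> sets ?V"
    using measurable_sets[of \<Theta> ?V borel]
    by (subst sets_vimage_algebra2) auto
  then have "indep_set (sets ?V') (sets ?W)"
    unfolding indep_sets2_eq
  proof (intro conjI ballI)
    fix S T assume "S \<in> sets ?V'" "T \<in> sets ?W"
    with \<open>sets ?V' \<subseteq> sets ?V\<close> have "prob (T \<inter> S) = prob T * prob S"
      by (intro indep_setD[OF indep]) auto
    then show "prob (S \<inter> T) = prob S * prob T"
      by (simp add: Int_commute mult.commute)
  qed (use indep_setD_ev1[OF indep] indep_setD_ev2[OF indep] in auto)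
  then show "indep_set (sigma_sets (space M) {\<Theta> -` A \<inter> space M |A. A \<in> sets borel})
      (sigma_sets (space M) {W -` A \<inter> space M |A. A \<in> sets borel})"
    by (simp add: sets_vimage_algebra)
qed simp_all

text \<open>The expectation is moved to the joint law of angle and fading, the fading is integrated
  first, and the law of the angle up to \<open>b\<close> is replaced by its density. An infinite
  expectation is a case of its own: by convention both integrals are then 0.\<close>

lemma average_rate_LU_eq:
  assumes b: "0 < b" "b < pi / 2" and pos: "0 < \<xi>" "0 < B" "R0 < Rsat"
    and nonneg: "AE \<omega> in M. 0 \<le> W \<omega>"
    and fW[measurable]: "fW \<in> borel_measurable borel" and fW_nonneg: "\<And>w. 0 \<le> fW w"
    and distrib: "distributed M lborel W (\<lambda>w. ennreal (fW w))"
    and indep: "indep_set (sets (vimage_algebra (space M) W borel))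
      (sets (vimage_algebra (space M) (\<lambda>\<omega>. \<lambda>i\<in>{..<N}. X i \<omega>) (Pi\<^sub>M {..<N} (\<lambda>_. borel))))"
  shows "average_rate_LU M c N user X W b \<xi> B =
    (LBINT \<theta>:{0..b}. LBINT w:{0..}. B * fW w * f_theta_LU N \<theta> *
       log 2 (1 + \<xi> * w / (r_of_angle Rsat R0 \<theta>)\<^sup>2))"
proof -
  have W[measurable]: "W \<in> borel_measurable M"
    using distributed_measurable[OF distrib] by simp
  define P\<Theta> PW where "P\<Theta> = distr M borel \<Theta>" and "PW = distr M borel W"
  interpret P\<Theta>: prob_space P\<Theta> unfolding P\<Theta>_def by (rule prob_space_distr) simp
  interpret PW: prob_space PW unfolding PW_def by (rule prob_space_distr) simp
  interpret pair_sigma_finite P\<Theta> PW ..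
  have sets_P[measurable_cong]: "sets P\<Theta> = sets borel" "sets PW = sets borel"
    by (simp_all add: P\<Theta>_def PW_def)
  have PW_nonneg: "AE w in PW. 0 \<le> w"
    unfolding PW_def using nonneg by (subst AE_distr_iff) auto
  \<comment> \<open>The SNR per unit of fading power at angle \<theta>.\<close>
  define a where "a = (\<lambda>\<theta>. \<xi> / (r_of_angle Rsat R0 \<theta>)\<^sup>2)"
  have a_meas[measurable]: "a \<in> borel_measurable borel" unfolding a_def by measurable
  have d: "0 < (Rsat - R0)\<^sup>2" using pos by simp
  have a_pos: "0 < a \<theta>" and a_le: "a \<theta> \<le> \<xi> / (Rsat - R0)\<^sup>2" for \<theta>
    using r_of_angle_sq_ge[OF Rsat R0, of \<theta>] d pos
    by (auto simp: a_def intro!: divide_pos_pos divide_left_mono mult_pos_pos)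
  define g where "g = (\<lambda>(\<theta>, w). indicator {..b} \<theta> * (B * log 2 (1 + a \<theta> * w)) :: real)"
  \<comment> \<open>The conditional mean rate given the angle, before the cut-off at
    \<open>b\<close>.\<close>
  define H where "H = (\<lambda>\<theta>. \<integral>w. B * log 2 (1 + a \<theta> * w) \<partial>PW)"
  have g_meas[measurable]: "g \<in> borel_measurable (borel \<Otimes>\<^sub>M borel)"
    unfolding g_def by measurable
  then have g_meas'[measurable]: "g \<in> borel_measurable (P\<Theta> \<Otimes>\<^sub>M PW)"
    by (simp cong: measurable_cong_sets add: sets_P)
  have H_meas[measurable]: "H \<in> borel_measurable borel"
    unfolding H_def by measurable
  \<comment> \<open>Independence in the form needed for Fubini: the joint law is the product
    law.\<close>
  have pair: "P\<Theta> \<Otimes>\<^sub>M PW = distr M (borel \<Otimes>\<^sub>M borel) (\<lambda>\<omega>. (\<Theta> \<omega>, W \<omega>))"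
    using indep_var_\<Theta>[OF W indep] by (simp add: indep_var_distribution_eq P\<Theta>_def PW_def)
  have "average_rate_LU M c N user X W b \<xi> B = (\<integral>\<omega>. g (\<Theta> \<omega>, W \<omega>) \<partial>M)"
    unfolding average_rate_LU_def SNR_LU_def \<Theta>_def[symmetric]
  proof (rule integral_cong_AE)
    show "AE \<omega> in M. indicator {..b} (\<Theta> \<omega>) * (B * log 2 (1 + \<xi> * W \<omega> / (r_LU N user (\<lambda>i. X i \<omega>))\<^sup>2)) =
      g (\<Theta> \<omega>, W \<omega>)"
      using AE_r_LU by eventually_elim (simp add: g_def a_def)
  qed measurable
  also have "\<dots> = (\<integral>z. g z \<partial>(P\<Theta> \<Otimes>\<^sub>M PW))"
    unfolding pair by (subst integral_distr) auto
  also have "\<dots> = (\<integral>\<theta>. indicator {..b} \<theta> * H \<theta> \<partial>P\<Theta>)"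
  \<comment> \<open>The factor \<open>\<xi> / (Rsat - R0)\<^sup>2\<close> belongs to a leader at the
    zenith and bounds every \<open>a \<theta>\<close>; if its rate is integrable, it dominates
    \<open>g\<close>.\<close>
  proof (cases "integrable PW (\<lambda>w. log 2 (1 + \<xi> / (Rsat - R0)\<^sup>2 * w))")
    case True
    let ?k = "\<lambda>w. B * log 2 (1 + \<xi> / (Rsat - R0)\<^sup>2 * w)"
    have "integrable M (\<lambda>\<omega>. ?k (W \<omega>))"
      using True by (auto simp: PW_def integrable_distr_eq)
    then have "integrable M (\<lambda>\<omega>. g (\<Theta> \<omega>, W \<omega>))"
    proof (rule Bochner_Integration.integrable_bound)
      show "AE \<omega> in M. norm (g (\<Theta> \<omega>, W \<omega>)) \<le> norm (?k (W \<omega>))"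
        using nonneg
      proof eventually_elim
        case (elim \<omega>)
        have "a (\<Theta> \<omega>) * W \<omega> \<le> \<xi> / (Rsat - R0)\<^sup>2 * W \<omega>"
          using a_le elim by (rule mult_right_mono)
        moreover have "0 \<le> a (\<Theta> \<omega>) * W \<omega>" using a_pos[of "\<Theta> \<omega>"] elim by simp
        ultimately have "0 \<le> log 2 (1 + a (\<Theta> \<omega>) * W \<omega>)"
          "log 2 (1 + a (\<Theta> \<omega>) * W \<omega>) \<le> log 2 (1 + \<xi> / (Rsat - R0)\<^sup>2 * W \<omega>)"
          by (auto simp del: times_divide_eq_left)
        then show ?case
          using pos by (auto simp: g_def abs_mult indicator_def simp del: times_divide_eq_left)
      qed
    qed measurable
    then have "integrable (P\<Theta> \<Otimes>\<^sub>M PW) g"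
      unfolding pair by (subst integrable_distr_eq) auto
    from integral_fst'[OF this] show ?thesis
      by (simp add: g_def H_def)
  next
    case False
    have not_int: "\<not> integrable PW (\<lambda>w. log 2 (1 + a \<theta> * w))" for \<theta>
      using False integrable_log_one_plus_mult[OF sets_P(2) PW_nonneg _ a_pos] pos d
      by (meson divide_pos_pos)
    \<comment> \<open>Almost all sections of an integrable function are integrable, but no section
      at an angle up to \<open>b\<close> is. So such angles would have probability 0, contrary to
      \<open>prob_\<Theta>_le\<close> with \<open>b > 0\<close>.\<close>
    have "\<not> integrable (P\<Theta> \<Otimes>\<^sub>M PW) g"
    proof
      assume "integrable (P\<Theta> \<Otimes>\<^sub>M PW) g"
      from AE_integrable_fst'[OF this] have "AE \<theta> in P\<Theta>. \<not> \<theta> \<le> b"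
      proof eventually_elim
        case (elim \<theta>)
        show ?case
        proof
          assume "\<theta> \<le> b"
          with elim pos not_int[of \<theta>] show False by (simp add: g_def)
        qed
      qed
      then have "AE \<omega> in M. \<not> \<Theta> \<omega> \<le> b"
        unfolding P\<Theta>_def by (subst (asm) AE_distr_iff) auto
      then have "prob {\<omega> \<in> space M. \<Theta> \<omega> \<le> b} = 0"
        by (intro measure_eq_0_null_sets) (simp add: AE_iff_null_sets[symmetric] AE_iff_null)
      moreover have "((1 + cos b) / 2) ^ N < 1"
      proof -
        have "cos b < 1" using b cos_monotone_0_pi[of 0 b] pi_gt_zero by simp
        moreover have "0 < cos b" using b by (auto intro!: cos_gt_zero_pi)
        ultimately show ?thesis using N by (simp add: power_less_one_iff)
      qed
      ultimately show False using prob_\<Theta>_le[of b] b by simp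
    qed
    \<comment> \<open>The Bochner integral of a non-integrable function is 0, so the two sides
      agree.\<close>
    moreover have "H \<theta> = 0" for \<theta>
      using not_int pos by (simp add: H_def not_integrable_integral_eq)
    ultimately show ?thesis by (simp add: not_integrable_integral_eq)
  qed
  also have "\<dots> = (\<integral>\<theta>. H \<theta> \<partial>density P\<Theta> (\<lambda>\<theta>. ennreal (indicator {..b} \<theta>)))"
    by (subst integral_density) auto
  also have "density P\<Theta> (\<lambda>\<theta>. ennreal (indicator {..b} \<theta>)) =
    density lborel (\<lambda>\<theta>. ennreal (f_theta_LU N \<theta> * indicator {0..b} \<theta>))"
    using distr_\<Theta>_restricted[of b] b
    by (simp add: P\<Theta>_def ennreal_indicator ennreal_mult'')
  also have "(\<integral>\<theta>. H \<theta> \<partial>\<dots>) = (\<integral>\<theta>. (f_theta_LU N \<theta> * indicator {0..b} \<theta>) * H \<theta> \<partial>lborel)"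
  proof -
    have "0 \<le> f_theta_LU N \<theta> * indicator {0..b} \<theta>" for \<theta>
      using f_theta_LU_nonneg[of \<theta> N] b pi_gt_zero by (auto simp: indicator_def)
    then show ?thesis by (subst integral_density) auto
  qed
  also have "\<dots> = (LBINT \<theta>:{0..b}. LBINT w:{0..}. B * fW w * f_theta_LU N \<theta> *
       log 2 (1 + \<xi> * w / (r_of_angle Rsat R0 \<theta>)\<^sup>2))"
    unfolding set_lebesgue_integral_def
  proof (rule Bochner_Integration.integral_cong[OF refl])
    fix \<theta> :: real
    \<comment> \<open>Nonnegativity of the fading inserts the indicator that confines the integral
      against \<open>fW\<close> to the half-line.\<close>
    have "H \<theta> = (\<integral>w. indicator {0..} w * (B * log 2 (1 + a \<theta> * w)) \<partial>PW)"
      unfolding H_def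
    proof (rule integral_cong_AE)
      show "AE w in PW. B * log 2 (1 + a \<theta> * w) = indicator {0..} w * (B * log 2 (1 + a \<theta> * w))"
        using PW_nonneg by eventually_elim simp
    qed measurable
    also have "PW = density lborel (\<lambda>w. ennreal (fW w))"
      using distributed_distr_eq_density[OF distrib] by (simp add: PW_def cong: distr_cong)
    also have "(\<integral>w. indicator {0..} w * (B * log 2 (1 + a \<theta> * w)) \<partial>\<dots>) =
      (\<integral>w. fW w * (indicator {0..} w * (B * log 2 (1 + a \<theta> * w))) \<partial>lborel)"
      using fW_nonneg by (subst integral_density) auto
    finally have "f_theta_LU N \<theta> * H \<theta> =
      (\<integral>w. f_theta_LU N \<theta> * (fW w * (indicator {0..} w * (B * log 2 (1 + a \<theta> * w)))) \<partial>lborel)"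
      by simp
    also have "\<dots> = (\<integral>w. indicator {0..} w *\<^sub>R (B * fW w * f_theta_LU N \<theta> *
       log 2 (1 + \<xi> * w / (r_of_angle Rsat R0 \<theta>)\<^sup>2)) \<partial>lborel)"
      by (rule Bochner_Integration.integral_cong[OF refl]) (simp add: a_def mult_ac)
    finally show "f_theta_LU N \<theta> * indicator {0..b} \<theta> * H \<theta> = indicator {0..b} \<theta> *\<^sub>R
      (\<integral>w. indicator {0..} w *\<^sub>R (B * fW w * f_theta_LU N \<theta> *
       log 2 (1 + \<xi> * w / (r_of_angle Rsat R0 \<theta>)\<^sup>2)) \<partial>lborel)"
      by (simp add: indicator_def)
  qed
  finally show ?thesis .
qed

end

theorem theorem3:
  fixes M :: "'w measure"
    and c user :: "real^3"
    and R0 h Rsat \<theta>cap \<theta>max :: real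
    and N :: nat
    and X :: "nat \<Rightarrow> 'w \<Rightarrow> real^3"
    and W :: "'w \<Rightarrow> real"
    and fW :: "real \<Rightarrow> real"
    and \<Omega> b0 m :: real
    and \<rho> G \<zeta> \<nu> \<sigma> B :: real
  assumes "prob_space M"
    and "R0 > 0" and "h > 0" and "Rsat = R0 + h"
    and "user \<in> sphere c R0"
    and "N \<ge> 1"
    and "prob_space.indep_vars M (\<lambda>_. borel) X {..<N}"
    and "\<And>i. i < N \<Longrightarrow> distr M borel (X i) = uniform_sphere c Rsat"
    and "\<theta>cap > 0" and "0 < \<theta>max" and "\<theta>max \<le> arccos (R0 / Rsat) - \<theta>cap"
    and "\<rho> > 0" and "G > 0" and "\<zeta> > 0" and "\<nu> > 0" and "\<sigma> > 0" and "B > 0"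
    and "\<Omega> > 0" and "b0 > 0" and "m > 0"
    and "AE \<omega> in M. W \<omega> \<ge> 0"
    and "fW \<in> borel_measurable borel" and "\<And>w. fW w \<ge> 0"
    and "distributed M lborel W (\<lambda>w. ennreal (fW w))"
    and "\<And>w. w \<ge> 0 \<Longrightarrow> cdf (distr M borel W) w = shadowed_rician_cdf \<Omega> b0 m w"
    and "prob_space.indep_set M
           (sets (vimage_algebra (space M) W borel))
           (sets (vimage_algebra (space M) (\<lambda>\<omega>. \<lambda>i\<in>{..<N}. X i \<omega>)
              (Pi\<^sub>M {..<N} (\<lambda>_. borel))))"
  shows "average_rate_LU M c N user X W \<theta>max (xi_LU \<rho> G \<zeta> \<nu> \<sigma>) B =
    (LBINT \<theta>:{0..\<theta>max}. LBINT w:{0..}.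
       B * fW w * f_theta_LU N \<theta> *
       log 2 (1 + xi_LU \<rho> G \<zeta> \<nu> \<sigma> * w / (r_of_angle Rsat R0 \<theta>)\<^sup>2))"
proof -
  interpret leader_constellation M c user Rsat R0 N X
    using assms by (auto simp: leader_constellation_def leader_constellation_axioms_def dist_norm norm_minus_commute)
  \<comment> \<open>The quotient is nonnegative; subtracting \<open>\<theta>cap > 0\<close> makes
    the bound on \<open>\<theta>max\<close> strict.\<close>
  have "arccos (R0 / Rsat) \<le> pi / 2"
    using assms by (intro arccos_le_pi2) auto
  then have "\<theta>max < pi / 2"
    using assms by linarith
  moreover have "0 < xi_LU \<rho> G \<zeta> \<nu> \<sigma>"
    using assms by (auto simp: xi_LU_def intro!: mult_pos_pos zero_less_power divide_pos_pos)
  ultimately show ?thesis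
    using assms by (intro average_rate_LU_eq) auto
qed

end
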